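(* Let $g\in\mathbb{R}$, $\gamma>0$, $p\in[0,1]$, $m\in\mathbb{R}$ and $v>0$, let $L(\cdot)=L(\cdot\,;m,v)$ be the Lognormal distribution function with meanlog $m$ and varlog $v$, and define $F:\mathbb{R}\to[0,1]$ by $$F(y)=\begin{cases}0, & y<g,\\ 1-p, & y=g,\\ 1-p+p\,L(y-g+\gamma), & y>g.\end{cases}$$ Then for every $u\ge g$, $$\mathrm{CRPS}(F,u) = (u-g)+2p\int_\gamma^{u-g+\gamma}(L(z)-1)\,dz+p^2\int_\gamma^\infty (L(z)-1)^2\,dz.$$
   Context: The Lognormal distribution function with meanlog $m$ and varlog $v$ is the distribution function of a random variable $Z$ with $\ln Z\sim\mathcal{N}(m,v)$ ($v$ being the variance), i.e. $L(z;m,v)=\frac12\left[1+\mathrm{erf}\left(\frac{\ln z-m}{\sqrt{2v}}\right)\right]$ for $z>0$. The (negatively oriented) continuous ranked probability score of a function $F$ and an observation $y\in\mathbb{R}$ is $$\mathrm{CRPS}(F,y)=\int_{\mathbb{R}}\left(F(z)-H(z\ge y)\right)^2dz,$$ where $H(z\ge y)$ equals $1$ if $z\ge y$ and $0$ otherwise (Heaviside step function). *)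

theory Defs
  imports "HOL-Probability.Probability"
begin

text \<open>The law of a random variable whose logarithm is normal with mean \<open>m\<close> and variance \<open>v\<close>.
  The second parameter of \<^const>\<open>normal_density\<close> is the standard deviation.\<close>

definition lognormal :: "real \<Rightarrow> real \<Rightarrow> real measure" where
  "lognormal m v = distr (density lborel (\<lambda>x. ennreal (normal_density m (sqrt v) x))) borel exp"

definition lognormal_cdf :: "real \<Rightarrow> real \<Rightarrow> real \<Rightarrow> real" where
  "lognormal_cdf m v = cdf (lognormal m v)"

text \<open>The Lebesgue integral of a non-integrable function is \<open>0\<close> by convention, so a value of
  \<open>crps\<close> is meaningful only together with \<open>crps_finite\<close>.\<close>

definition crps :: "(real \<Rightarrow> real) \<Rightarrow> real \<Rightarrow> real" where
  "crps F y = (LBINT z. (F z - (if z \<ge> y then 1 else 0))\<^sup>2)"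

definition crps_finite :: "(real \<Rightarrow> real) \<Rightarrow> real \<Rightarrow> bool" where
  "crps_finite F y \<longleftrightarrow> integrable lborel (\<lambda>z. (F z - (if z \<ge> y then 1 else 0))\<^sup>2)"

text \<open>The library has no error function; it is needed only for the closed form of
  \<^const>\<open>lognormal_cdf\<close> in \<open>lognormal_cdf_erf\<close>.\<close>

definition erf :: "real \<Rightarrow> real" where
  "erf x = 2 / sqrt pi * (LBINT t=0..x. exp (- t\<^sup>2))"

lemma lognormal_cdf_nonpos:
  assumes "z \<le> 0"
  shows "lognormal_cdf m v z = 0"
proof -
  have "{x. exp x \<le> z} = {}"
    using assms by (auto simp: not_le intro: le_less_trans)
  then show ?thesis
    by (simp add: lognormal_cdf_def cdf_def lognormal_def measure_distr vimage_def)
qed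

lemma integrable_gauss: "integrable lborel (\<lambda>t::real. exp (- t\<^sup>2))"
  and integral_gauss_neg: "(LBINT t=-\<infinity>..0. exp (- t\<^sup>2)) = sqrt pi / 2"
proof -
  have 1: "has_bochner_integral lborel (\<lambda>x::real. indicator {0..} x *\<^sub>R exp (- x\<^sup>2)) (sqrt pi / 2)"
    by (rule gaussian_moment_0)
  show "integrable lborel (\<lambda>t::real. exp (- t\<^sup>2))"
    using has_bochner_integral_even_function[OF 1] by (simp add: has_bochner_integral_iff)
  have "(LBINT t=-\<infinity>..0. exp (- t\<^sup>2)) = (LBINT t=0..\<infinity>. exp (- t\<^sup>2 :: real))"
    by (subst interval_integral_reflect) simp
  also have "\<dots> = (LBINT t:{0<..}. exp (- t\<^sup>2 :: real))"
    by (simp add: interval_lebesgue_integral_0_infty)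
  also have "\<dots> = (LBINT t:{0..}. exp (- t\<^sup>2 :: real))"
    unfolding set_lebesgue_integral_def
    by (rule integral_cong_AE)
       (auto intro!: AE_I[where N="{0}"] simp: indicator_def split: if_splits)
  also have "\<dots> = sqrt pi / 2"
    using 1 by (simp add: has_bochner_integral_iff set_lebesgue_integral_def)
  finally show "(LBINT t=-\<infinity>..0. exp (- t\<^sup>2)) = sqrt pi / 2" .
qed

lemma lognormal_cdf_erf:
  assumes v: "v > 0" and z: "z > 0"
  shows "lognormal_cdf m v z = 1 / 2 * (1 + erf ((ln z - m) / sqrt (2 * v)))"
proof -
  define w where "w = (ln z - m) / sqrt (2 * v)"
  define s where "s = sqrt (2 * v)"
  have s: "s > 0" "s\<^sup>2 = 2 * v" using v by (auto simp: s_def)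
  let ?n = "normal_density m (sqrt v)"
  have set_eq: "{x. exp x \<le> z} = {..ln z}"
    using z by (auto simp: ln_ge_iff)
  have "lognormal_cdf m v z = measure (density lborel (\<lambda>x. ennreal (?n x))) {..ln z}"
    by (simp add: lognormal_cdf_def cdf_def lognormal_def measure_distr vimage_def set_eq)
  also have "\<dots> = (LBINT x. ?n x * indicator {..ln z} x)"
    using integral_density[of "indicator {..ln z} :: real \<Rightarrow> real" lborel ?n] by simp
  also have "\<dots> = s * (LBINT t. ?n (m + s * t) * indicator {..ln z} (m + s * t))"
    using s by (subst lborel_integral_real_affine[where c=s and t=m]) auto
  also have "(\<lambda>t. ?n (m + s * t) * indicator {..ln z} (m + s * t)) =
      (\<lambda>t. 1 / (sqrt pi * s) * (indicator {..w} t *\<^sub>R exp (- t\<^sup>2)))"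
  proof
    fix t
    have "m + s * t \<le> ln z \<longleftrightarrow> t \<le> w"
      using s by (simp add: w_def flip: s_def) (simp add: field_simps)
    moreover have "(m + s * t - m)\<^sup>2 / (2 * (sqrt v)\<^sup>2) = t\<^sup>2"
      using s v by (simp add: power_mult_distrib)
    moreover have "sqrt (2 * pi * (sqrt v)\<^sup>2) = sqrt pi * s"
      using v by (simp add: s_def real_sqrt_mult)
    ultimately show "?n (m + s * t) * indicator {..ln z} (m + s * t) =
        1 / (sqrt pi * s) * (indicator {..w} t *\<^sub>R exp (- t\<^sup>2))"
      by (simp add: normal_density_def indicator_def)
  qed
  also have "s * (LBINT t. 1 / (sqrt pi * s) * (indicator {..w} t *\<^sub>R exp (- t\<^sup>2)))
      = 1 / sqrt pi * (LBINT t:{..w}. exp (- t\<^sup>2))"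
    using s by (simp add: set_lebesgue_integral_def)
  also have "(LBINT t:{..w}. exp (- t\<^sup>2)) = (LBINT t:{..<w}. exp (- t\<^sup>2))"
    unfolding set_lebesgue_integral_def
    by (rule integral_cong_AE)
       (auto intro!: AE_I[where N="{w}"] simp: indicator_def split: if_splits)
  also have "\<dots> = (LBINT t=-\<infinity>..w. exp (- t\<^sup>2))"
    by (simp add: interval_lebesgue_integral_def)
  also have "\<dots> = (LBINT t=-\<infinity>..0. exp (- t\<^sup>2)) + (LBINT t=0..w. exp (- t\<^sup>2))"
  proof (rule interval_integral_sum[symmetric])
    have "set_integrable lborel A (\<lambda>t::real. exp (- t\<^sup>2))" if "A \<in> sets lborel" for A
      unfolding set_integrable_def using integrable_gauss that by (rule integrable_mult_indicator[rotated])
    then show "interval_lebesgue_integrable lborel (min (-\<infinity>) (min 0 (ereal w)))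
        (max (-\<infinity>) (max 0 (ereal w))) (\<lambda>t::real. exp (- t\<^sup>2))"
      by (simp add: interval_lebesgue_integrable_def)
  qed
  finally show ?thesis
    by (simp add: integral_gauss_neg erf_def w_def field_simps)
qed

end

theory Submission
  imports Defs "HOL-Real_Asymp.Real_Asymp"
begin

text \<open>After the shift \<open>z \<mapsto> z - g + \<gamma>\<close> the integrand of the score is \<open>(1 + p (L - 1))\<^sup>2\<close> on
  \<open>(\<gamma>, u - g + \<gamma>)\<close> and \<open>p\<^sup>2 (L - 1)\<^sup>2\<close> beyond; expanding the first square gives the three terms.
  The lognormal law has a finite mean, so Markov's inequality gives \<open>1 - L(z) \<le> C / z\<close>, which
  makes \<open>(L - 1)\<^sup>2\<close> integrable at infinity.\<close>

text \<open>Completing the square in the exponent turns the factor \<open>exp x\<close> into a shift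
  of the mean by \<open>\<sigma>\<^sup>2\<close>, up to the constant
  \<open>exp (m + \<sigma>\<^sup>2 / 2)\<close>. This yields the finite mean of the lognormal
  law.\<close>

lemma integrable_normal_density_exp:
  fixes m \<sigma> :: real
  assumes "\<sigma> > 0"
  shows "integrable lborel (\<lambda>x. normal_density m \<sigma> x * exp x)"
proof -
  have "normal_density m \<sigma> x * exp x = exp (m + \<sigma>\<^sup>2 / 2) * normal_density (m + \<sigma>\<^sup>2) \<sigma> x" for x
  proof -
    have "- (x - m)\<^sup>2 / (2 * \<sigma>\<^sup>2) + x = (m + \<sigma>\<^sup>2 / 2) + - (x - (m + \<sigma>\<^sup>2))\<^sup>2 / (2 * \<sigma>\<^sup>2)"
      using assms by (simp add: field_simps power2_eq_square)
    then show ?thesis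
      by (simp add: normal_density_def flip: exp_add)
  qed
  then show ?thesis
    using assms by simp
qed

lemma real_distribution_lognormal:
  assumes "v > 0"
  shows "real_distribution (lognormal m v)"
proof -
  interpret prob_space "density lborel (\<lambda>x. ennreal (normal_density m (sqrt v) x))"
    using assms by (intro prob_space_normal_density) simp
  show ?thesis
    unfolding lognormal_def by (rule real_distribution_distr) simp
qed

lemma AE_lognormal_pos: "AE z in lognormal m v. 0 < z"
  unfolding lognormal_def by (subst AE_distr_iff) auto

lemma integrable_lognormal_ident:
  assumes "v > 0"
  shows "integrable (lognormal m v) (\<lambda>z. z)"
  unfolding lognormal_def
  using assms integrable_normal_density_exp[of "sqrt v" m]
  by (subst integrable_distr_eq) (auto simp: integrable_density)

lemma (in real_distribution) borel_measurable_cdf: "cdf M \<in> borel_measurable borel"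
  by (intro borel_measurable_mono monoI cdf_nondecreasing)

text \<open>The tail is the mass of the open half-line above \<open>z\<close>; enlarging it to the
  closed one puts it in the form of Markov's inequality.\<close>

lemma (in real_distribution) cdf_tail_Markov:
  assumes "integrable M (\<lambda>x. x)" and "AE x in M. 0 \<le> x" and "z > 0"
  shows "1 - cdf M z \<le> expectation (\<lambda>x. x) / z"
proof -
  have "1 - cdf M z = prob {z<..}"
    using prob_compl[of "{..z}"] by (simp add: cdf_def Compl_eq_Diff_UNIV[symmetric])
  also have "\<dots> \<le> prob {x \<in> space M. z \<le> x}"
    by (intro finite_measure_mono) auto
  also have "\<dots> \<le> expectation (\<lambda>x. x) / z"
    using assms by (intro integral_Markov_inequality_measure[where A="{}"]) auto
  finally show ?thesis .
qed

text \<open>The antiderivative \<open>- 1 / x\<close> has finite limits \<open>- 1 / a\<close> and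
  \<open>0\<close> at the two ends, which suffices because the integrand is nonnegative.\<close>

lemma set_integrable_inverse_square:
  fixes a :: real
  assumes "a > 0"
  shows "set_integrable lborel {a<..} (\<lambda>x. 1 / x\<^sup>2)"
proof -
  have "((\<lambda>x::real. - 1 / x) \<longlongrightarrow> 0) at_top" by real_asymp
  then have "set_integrable lborel (einterval a \<infinity>) (\<lambda>x. 1 / x\<^sup>2)"
    using assms
    by (intro interval_integral_FTC_nonneg[where F="\<lambda>x. - 1 / x" and A="- 1 / a" and B=0])
       (auto intro!: derivative_eq_intros continuous_intros tendsto_eq_intros AE_I2
             simp: power2_eq_square ereal_tendsto_simps)
  then show ?thesis by simp
qed

lemma set_integrable_lognormal_tail_square:
  assumes "v > 0" and "a > 0"
  shows "set_integrable lborel {a<..} (\<lambda>z. (lognormal_cdf m v z - 1)\<^sup>2)"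
proof -
  interpret real_distribution "lognormal m v"
    using assms by (intro real_distribution_lognormal)
  define C where "C = expectation (\<lambda>x. x)"
  have [measurable]: "lognormal_cdf m v \<in> borel_measurable borel"
    unfolding lognormal_cdf_def by (rule borel_measurable_cdf)
  have bound: "(lognormal_cdf m v z - 1)\<^sup>2 \<le> C\<^sup>2 * (1 / z\<^sup>2)" if "z > a" for z
  proof -
    have "1 - lognormal_cdf m v z \<le> C / z"
      unfolding C_def lognormal_cdf_def
      using that assms AE_lognormal_pos[of m v]
      by (intro cdf_tail_Markov integrable_lognormal_ident) (auto elim: eventually_mono)
    \<comment> \<open>Nonnegativity allows the Markov bound to be squared.\<close>
    moreover have "0 \<le> 1 - lognormal_cdf m v z"
      using cdf_bounded_prob[of z] by (simp add: lognormal_cdf_def)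
    ultimately have "(1 - lognormal_cdf m v z)\<^sup>2 \<le> (C / z)\<^sup>2"
      by (intro power_mono)
    then show ?thesis
      by (simp add: power_divide power2_commute)
  qed
  have "set_integrable lborel {a<..} (\<lambda>z. C\<^sup>2 * (1 / z\<^sup>2))"
    using set_integrable_inverse_square[OF assms(2)] by (intro set_integrable_mult_right) auto
  then show ?thesis
    by (rule set_integrable_bound)
       (use bound in \<open>auto simp: set_borel_measurable_def intro!: AE_I2\<close>)
qed

theorem lemma4p1:
  fixes g \<gamma> p m v u :: real and L F :: "real \<Rightarrow> real"
  assumes "\<gamma> > 0" and "0 \<le> p" and "p \<le> 1" and "v > 0"
    and L: "L = lognormal_cdf m v"
    and F: "F = (\<lambda>y. if y < g then 0
                     else if y = g then 1 - p
                     else 1 - p + p * L (y - g + \<gamma>))"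
    and "u \<ge> g"
  shows "crps_finite F u
      \<and> interval_lebesgue_integrable lborel \<gamma> (u - g + \<gamma>) (\<lambda>z. L z - 1)
      \<and> interval_lebesgue_integrable lborel \<gamma> \<infinity> (\<lambda>z. (L z - 1)\<^sup>2)
      \<and> crps F u = (u - g)
           + 2 * p * (LBINT z=\<gamma>..(u - g + \<gamma>). L z - 1)
           + p\<^sup>2 * (LBINT z=\<gamma>..\<infinity>. (L z - 1)\<^sup>2)"
proof -
  interpret real_distribution "lognormal m v"
    using assms by (intro real_distribution_lognormal)
  have [measurable]: "L \<in> borel_measurable borel"
    unfolding L lognormal_cdf_def by (rule borel_measurable_cdf)
  define I where "I = {\<gamma><..<u - g + \<gamma>}"
  define J where "J = {\<gamma><..}"
  have I_sets [measurable]: "I \<in> sets borel" and J_sets [measurable]: "J \<in> sets borel"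
    by (auto simp: I_def J_def)
  have one: "set_integrable lborel I (\<lambda>z. 1 :: real)"
    using \<open>u \<ge> g\<close> by (simp add: set_integrable_def I_def integrable_indicator_iff)
  have lin: "set_integrable lborel I (\<lambda>z. L z - 1)"
    using one
  proof (rule set_integrable_bound)
    have "\<bar>L z - 1\<bar> \<le> 1" for z
      using cdf_bounded_prob[of z] cdf_nonneg[of z] by (simp add: L lognormal_cdf_def)
    then show "AE z in lborel. z \<in> I \<longrightarrow> norm (L z - 1) \<le> norm (1 :: real)"
      by simp
  qed (simp add: set_borel_measurable_def)
  have sq: "set_integrable lborel J (\<lambda>z. (L z - 1)\<^sup>2)"
    unfolding L J_def using assms by (intro set_integrable_lognormal_tail_square)
  \<comment> \<open>\<open>K\<close> is the shifted integrand, already split into the three terms.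
    Since \<open>I\<close> lies inside \<open>J\<close>, the terms add up to
    \<open>(1 + p * (L z - 1))\<^sup>2\<close> on \<open>I\<close>, and only the last one survives
    on the rest of \<open>J\<close>.\<close>
  define K where "K z = indicator I z *\<^sub>R 1 + 2 * p * (indicator I z *\<^sub>R (L z - 1))
      + p\<^sup>2 * (indicator J z *\<^sub>R (L z - 1)\<^sup>2)" for z
  define G where "G z = (F z - (if z \<ge> u then 1 else 0))\<^sup>2" for z
  have G_meas [measurable]: "G \<in> borel_measurable borel"
    unfolding G_def F by measurable
  have K_meas [measurable]: "K \<in> borel_measurable borel"
    unfolding K_def by measurable
  have K: "integrable lborel K"
    using one lin sq unfolding K_def set_integrable_def by auto
  \<comment> \<open>The atom at \<open>g\<close> is left out: there the argument of \<open>K\<close>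
    is \<open>\<gamma>\<close>, outside both open intervals, so \<open>K\<close> vanishes while
    \<open>G\<close> need not. A single point is null. The factor \<open>1\<close> fits the affine
    substitution rule.\<close>
  have "G z = K ((\<gamma> - g) + 1 * z)" if "z \<noteq> g" for z
    using that \<open>u \<ge> g\<close>
    by (auto simp: G_def K_def F I_def J_def indicator_def algebra_simps power2_eq_square)
  then have G_K: "AE z in lborel. G z = K ((\<gamma> - g) + 1 * z)"
    by (intro AE_I[where N="{g}"]) auto
  have "integrable lborel (\<lambda>z. K ((\<gamma> - g) + 1 * z))"
    using K by (intro lborel_integrable_real_affine) auto
  then have fin: "crps_finite F u"
    unfolding crps_finite_def G_def[symmetric]
    by (subst integrable_cong_AE[OF _ _ G_K]) auto
  have "crps F u = (LBINT z. K ((\<gamma> - g) + 1 * z))"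
    unfolding crps_def G_def[symmetric] using G_K by (intro integral_cong_AE) auto
  also have "\<dots> = (LBINT z. K z)"
    using lborel_integral_real_affine[of 1 K "\<gamma> - g"] by simp
  also have "\<dots> = (LBINT z:I. 1) + 2 * p * (LBINT z:I. L z - 1) + p\<^sup>2 * (LBINT z:J. (L z - 1)\<^sup>2)"
    using one lin sq unfolding K_def set_integrable_def set_lebesgue_integral_def by simp
  also have "(LBINT z:I. 1) = u - g"
    using \<open>u \<ge> g\<close> by (simp add: I_def set_lebesgue_integral_def)
  \<comment> \<open>As \<open>u \<ge> g\<close>, the limits are in order, so the interval integrals
    are the set integrals over \<open>I\<close> and \<open>J\<close>.\<close>
  finally show ?thesis
    using fin lin sq \<open>u \<ge> g\<close>
    by (simp add: I_def J_def interval_lebesgue_integrable_def interval_lebesgue_integral_def)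
qed

end
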